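(* The categories $\mathbf{A}$ and $\mathbf{A}\cap\mathbf{F}$ have amalgamation.
   Context: A graph is a finite non-empty set $G$ with a reflexive symmetric relation $\sqcap$ (the edge relation). A path is a graph whose vertices can be listed without repetition as $p_0,\dots,p_k$ ($k\ge0$) so that $p_i\sqcap p_j$ iff $|i-j|\le1$. A subset of a graph is connected if it cannot be split into two non-empty parts with no edge between them (the empty set is connected). A relation $R\subseteq H\times G$ between graphs is viewed as a relation from $G$ to $H$; write $R(g)=\{h:(h,g)\in R\}$ and $R^{-1}(h)=\{g:(h,g)\in R\}$; $(c,a)\in Q\circ R$ iff $(c,b)\in Q$ and $(b,a)\in R$ for some $b$. $R$ is: edge-preserving if $(h,g),(h',g')\in R$ and $g\sqcap g'$ imply $h\sqcap h'$; co-bijective if $R(g)\neq\emptyset$ for all $g\in G$ and for all $h\in H$ there is $g\in G$ with $R(g)=\{h\}$; monotone if $\bigcup_{h\in C}R^{-1}(h)$ is connected for every connected $C\subseteq H$; a function if each $R(g)$ is a singleton. $\mathbf{A}$ is the category of paths with monotone co-bijective edge-preserving relations as morphisms; $\mathbf{A}\cap\mathbf{F}$ is the category of paths whose morphisms are those morphisms of $\mathbf{A}$ that are functions. A category $\mathbf{C}$ (with $\mathbf{C}^H_G$ the morphisms from $G$ to $H$) has amalgamation if for all $R\in\mathbf{C}^G_H$, $Q\in\mathbf{C}^G_I$ there are an object $J$ and $R'\in\mathbf{C}^H_J$, $Q'\in\mathbf{C}^I_J$ with $R\circ R'=Q\circ Q'$. *)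

theory Defs
  imports Main "HOL-Library.Infinite_Typeclass"
begin

record 'a graph =
  verts :: "'a set"
  edges :: "('a \<times> 'a) set"

definition is_graph :: "'a graph \<Rightarrow> bool" where
  "is_graph G \<longleftrightarrow> finite (verts G) \<and> verts G \<noteq> {} \<and>
     edges G \<subseteq> verts G \<times> verts G \<and> refl_on (verts G) (edges G) \<and> sym (edges G)"

definition is_path :: "'a graph \<Rightarrow> bool" where
  "is_path G \<longleftrightarrow> is_graph G \<and>
     (\<exists>p. distinct p \<and> set p = verts G \<and>
        (\<forall>i<length p. \<forall>j<length p. (p ! i, p ! j) \<in> edges G \<longleftrightarrow> \<bar>int i - int j\<bar> \<le> 1))"

definition connected_in :: "'a graph \<Rightarrow> 'a set \<Rightarrow> bool" where
  "connected_in G C \<longleftrightarrow> C \<subseteq> verts G \<and>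
     (\<nexists>A B. A \<noteq> {} \<and> B \<noteq> {} \<and> A \<union> B = C \<and> A \<inter> B = {} \<and>
        (\<forall>a\<in>A. \<forall>b\<in>B. (a, b) \<notin> edges G))"

text \<open>
  A relation from a graph \<open>G\<close> to a graph \<open>H\<close> is a set \<open>R \<subseteq> verts H \<times> verts G\<close>, with the
  codomain on the left, and the arguments of the predicates below come in the order codomain,
  domain. In this convention the composite of \<open>Q\<close> after \<open>R\<close> is \<^term>\<open>Q O R\<close>, the union of
  \<open>R\<inverse>(h)\<close> over \<open>h \<in> C\<close> is \<^term>\<open>R `` C\<close>, and \<open>R(g)\<close> is \<open>img R g\<close>.
\<close>

definition img :: "('b \<times> 'a) set \<Rightarrow> 'a \<Rightarrow> 'b set" where
  "img R g = {h. (h, g) \<in> R}"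

definition edge_preserving :: "'b graph \<Rightarrow> 'a graph \<Rightarrow> ('b \<times> 'a) set \<Rightarrow> bool" where
  "edge_preserving H G R \<longleftrightarrow>
     (\<forall>h g h' g'. (h, g) \<in> R \<and> (h', g') \<in> R \<and> (g, g') \<in> edges G \<longrightarrow> (h, h') \<in> edges H)"

definition co_bijective :: "'b graph \<Rightarrow> 'a graph \<Rightarrow> ('b \<times> 'a) set \<Rightarrow> bool" where
  "co_bijective H G R \<longleftrightarrow>
     (\<forall>g\<in>verts G. img R g \<noteq> {}) \<and> (\<forall>h\<in>verts H. \<exists>g\<in>verts G. img R g = {h})"

definition monotone_rel :: "'b graph \<Rightarrow> 'a graph \<Rightarrow> ('b \<times> 'a) set \<Rightarrow> bool" where
  "monotone_rel H G R \<longleftrightarrow> (\<forall>C. connected_in H C \<longrightarrow> connected_in G (R `` C))"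

definition function_rel :: "'a graph \<Rightarrow> ('b \<times> 'a) set \<Rightarrow> bool" where
  "function_rel G R \<longleftrightarrow> (\<forall>g\<in>verts G. \<exists>h. img R g = {h})"

text \<open>
  Categories of graphs and relations: \<open>mor C H G\<close> is the set of morphisms from \<open>G\<close> to \<open>H\<close>;
  composition is relational composition and identities are identity relations.
\<close>

record 'a rel_cat =
  obj :: "'a graph set"
  mor :: "'a graph \<Rightarrow> 'a graph \<Rightarrow> ('a \<times> 'a) set set"

definition is_rel_cat :: "'a rel_cat \<Rightarrow> bool" where
  "is_rel_cat C \<longleftrightarrow>
     (\<forall>G\<in>obj C. is_graph G) \<and>
     (\<forall>G\<in>obj C. \<forall>H\<in>obj C. \<forall>R\<in>mor C H G. R \<subseteq> verts H \<times> verts G) \<and>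
     (\<forall>G\<in>obj C. Id_on (verts G) \<in> mor C G G) \<and>
     (\<forall>G\<in>obj C. \<forall>H\<in>obj C. \<forall>I\<in>obj C. \<forall>R\<in>mor C H G. \<forall>Q\<in>mor C I H. Q O R \<in> mor C I G)"

definition has_amalgamation :: "'a rel_cat \<Rightarrow> bool" where
  "has_amalgamation C \<longleftrightarrow>
     (\<forall>G\<in>obj C. \<forall>H\<in>obj C. \<forall>I\<in>obj C. \<forall>R\<in>mor C G H. \<forall>Q\<in>mor C G I.
        \<exists>J\<in>obj C. \<exists>R'\<in>mor C H J. \<exists>Q'\<in>mor C I J. R O R' = Q O Q')"

text \<open>
  The vertices of all graphs are drawn from one type. It has to be infinite, so that there are
  paths of every finite length and each finite graph has an isomorphic copy.
\<close>

definition cat_A :: "'a::infinite rel_cat" where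
  "cat_A = \<lparr>obj = {G. is_path G},
            mor = (\<lambda>H G. {R. R \<subseteq> verts H \<times> verts G \<and>
                     monotone_rel H G R \<and> co_bijective H G R \<and> edge_preserving H G R})\<rparr>"

definition cat_AF :: "'a::infinite rel_cat" where
  "cat_AF = \<lparr>obj = obj cat_A, mor = (\<lambda>H G. {R \<in> mor cat_A H G. function_rel G R})\<rparr>"

lemma monotone_rel_comp:
  "monotone_rel H G R \<Longrightarrow> monotone_rel I H Q \<Longrightarrow> monotone_rel I G (Q O R)"
  by (simp add: monotone_rel_def relcomp_Image)

lemma img_comp: "img (Q O R) g = (\<Union>h\<in>img R g. img Q h)"
  by (auto simp: img_def)

lemma img_Id_on: "img (Id_on A) g = (if g \<in> A then {g} else {})"
  by (auto simp: img_def)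

lemma img_subset: "R \<subseteq> A \<times> B \<Longrightarrow> img R g \<subseteq> A"
  by (auto simp: img_def)

lemma co_bijective_comp:
  assumes R: "R \<subseteq> verts H \<times> verts G" "co_bijective H G R" and Q: "co_bijective I H Q"
  shows "co_bijective I G (Q O R)"
  unfolding co_bijective_def
proof (intro conjI ballI)
  fix g assume "g \<in> verts G"
  then obtain h where "h \<in> img R g" using R(2) unfolding co_bijective_def by blast
  moreover from this have "h \<in> verts H" using img_subset[OF R(1)] by blast
  ultimately show "img (Q O R) g \<noteq> {}" using Q by (auto simp: co_bijective_def img_comp)
next
  fix i assume "i \<in> verts I"
  then obtain h where "h \<in> verts H" and h: "img Q h = {i}"
    using Q by (auto simp: co_bijective_def)
  then obtain g where "g \<in> verts G" "img R g = {h}"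
    using R(2) by (auto simp: co_bijective_def)
  with h show "\<exists>g\<in>verts G. img (Q O R) g = {i}"
    by (intro bexI[of _ g]) (simp_all add: img_comp)
qed

lemma function_rel_comp:
  assumes R: "R \<subseteq> verts H \<times> verts G" "function_rel G R" and Q: "function_rel H Q"
  shows "function_rel G (Q O R)"
  unfolding function_rel_def
proof
  fix g assume "g \<in> verts G"
  then obtain h where h: "img R g = {h}" using R(2) by (auto simp: function_rel_def)
  then have "h \<in> verts H" using img_subset[OF R(1), of g] by simp
  with Q h show "\<exists>i. img (Q O R) g = {i}" by (auto simp: function_rel_def img_comp)
qed

lemma edge_preserving_comp:
  "edge_preserving H G R \<Longrightarrow> edge_preserving I H Q \<Longrightarrow> edge_preserving I G (Q O R)"
  unfolding edge_preserving_def by blast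

lemma Id_on_Image_eq: "C \<subseteq> A \<Longrightarrow> Id_on A `` C = C"
  by auto

lemma is_rel_cat_A: "is_rel_cat cat_A"
  unfolding is_rel_cat_def cat_A_def
proof (simp, intro conjI allI impI ballI)
  fix G :: "'a graph" assume "is_path G"
  then show "is_graph G" by (simp add: is_path_def)
next
  fix G :: "'a graph"
  show "Id_on (verts G) \<subseteq> verts G \<times> verts G" by auto
  show "monotone_rel G G (Id_on (verts G))"
    unfolding monotone_rel_def
  proof (intro allI impI)
    fix C assume C: "connected_in G C"
    then have "C \<subseteq> verts G" by (simp add: connected_in_def)
    with C show "connected_in G (Id_on (verts G) `` C)" by (simp only: Id_on_Image_eq)
  qed
  show "co_bijective G G (Id_on (verts G))" by (auto simp: co_bijective_def img_Id_on)
  show "edge_preserving G G (Id_on (verts G))" by (auto simp: edge_preserving_def)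
qed (auto intro: monotone_rel_comp co_bijective_comp edge_preserving_comp)

lemma is_rel_cat_AF: "is_rel_cat cat_AF"
proof -
  have sub: "R \<subseteq> verts H \<times> verts G" if "R \<in> mor cat_A H G" for R and G H :: "'a graph"
    using that by (simp add: cat_A_def)
  have "function_rel G (Id_on (verts G))" for G :: "'a graph"
    by (simp add: function_rel_def img_Id_on)
  then show ?thesis
    using is_rel_cat_A[where 'a='a] unfolding is_rel_cat_def cat_AF_def
    by (auto intro: function_rel_comp[OF sub])
qed

end

theory Submission
  imports Defs
begin

text \<open>
  After listing the vertices, and reversing the listing of the domain if necessary, a morphism of
  \<open>A\<close> sends the vertex \<open>i\<close> to an interval \<open>{lo i..hi i}\<close> of at most two vertices, where \<open>lo\<close> and \<open>hi\<close>
  are nondecreasing. Encode the vertex \<open>k\<close> of a path as \<open>2 * k\<close> and its edge \<open>{k, k + 1}\<close> as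
  \<open>2 * k + 1\<close>. A morphism then becomes a nondecreasing map between initial segments of the natural
  numbers that preserves both endpoints and moves by at most one in each step. Two such maps
  \<open>f\<close>, \<open>g\<close> with the same endpoint admit a common walk: \<open>f \<circ> u = g \<circ> v\<close> with \<open>u\<close>, \<open>v\<close> of the same
  kind, and decoding \<open>u\<close> and \<open>v\<close> gives the amalgam. If both morphisms are functions, the same
  walk is applied to \<open>lo = hi\<close> without encoding.
\<close>

section \<open>Listings of paths and their connected subsets\<close>

text \<open>The listing is an explicit argument because a path with several vertices has two
  listings, and the choice of direction matters below.\<close>

definition path_list :: "'a graph \<Rightarrow> 'a list \<Rightarrow> bool" where
  "path_list G p \<longleftrightarrow> is_graph G \<and> distinct p \<and> set p = verts G \<and>
     (\<forall>i<length p. \<forall>j<length p. (p ! i, p ! j) \<in> edges G \<longleftrightarrow> i \<le> Suc j \<and> j \<le> Suc i)"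

lemma is_path_iff_path_list: "is_path G \<longleftrightarrow> (\<exists>p. path_list G p)"
proof -
  have "\<bar>int i - int j\<bar> \<le> 1 \<longleftrightarrow> i \<le> Suc j \<and> j \<le> Suc i" for i j by linarith
  then show ?thesis unfolding is_path_def path_list_def by simp
qed

lemma path_list_rev: "path_list G p \<Longrightarrow> path_list G (rev p)"
  unfolding path_list_def by (auto simp: rev_nth)

lemma path_list_edges_nth:
  "path_list G p \<Longrightarrow> i < length p \<Longrightarrow> j < length p \<Longrightarrow>
     (p ! i, p ! j) \<in> edges G \<longleftrightarrow> i \<le> Suc j \<and> j \<le> Suc i"
  by (simp add: path_list_def)

lemma path_list_length: "path_list G p \<Longrightarrow> \<exists>n. length p = Suc n"
  unfolding path_list_def is_graph_def by (cases p) auto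

text \<open>An index \<open>j\<close> missing from \<open>C\<close> splits \<open>C\<close> into the
  vertices before and after it, whose indices differ by at least two. Conversely, a convex
  \<open>C\<close> allows a walk through consecutive vertices from one side of a split to the other,
  and this walk has to change sides along an edge.\<close>

lemma connected_in_path_iff:
  assumes p: "path_list G p"
  shows "connected_in G C \<longleftrightarrow> C \<subseteq> verts G \<and>
    (\<forall>i j k. i < j \<longrightarrow> j < k \<longrightarrow> k < length p \<longrightarrow> p ! i \<in> C \<longrightarrow> p ! k \<in> C \<longrightarrow> p ! j \<in> C)"
    (is "_ \<longleftrightarrow> _ \<and> ?conv")
proof
  assume C: "connected_in G C"
  have ?conv
  proof (intro allI impI, rule ccontr)
    fix i j k
    assume ijk: "i < j" "j < k" "k < length p" "p ! i \<in> C" "p ! k \<in> C" "p ! j \<notin> C"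
    define A where "A = {x \<in> C. \<exists>a<j. x = p ! a}"
    define B where "B = {x \<in> C. \<exists>a. j < a \<and> a < length p \<and> x = p ! a}"
    have d: "distinct p" and C': "C \<subseteq> set p"
      using p C by (auto simp: path_list_def connected_in_def)
    have "p ! i \<in> A" "p ! k \<in> B" using ijk by (auto simp: A_def B_def)
    then have "A \<noteq> {}" "B \<noteq> {}" by auto
    moreover have "C \<subseteq> A \<union> B"
    proof
      fix x assume "x \<in> C"
      then obtain a where "a < length p" "x = p ! a" using C' by (metis in_set_conv_nth subsetD)
      then show "x \<in> A \<union> B" using \<open>x \<in> C\<close> ijk(6) by (cases a j rule: linorder_cases) (auto simp: A_def B_def)
    qed
    then have "A \<union> B = C" by (auto simp: A_def B_def)
    moreover have "A \<inter> B = {}"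
    proof -
      have False if "a < j" "j < b" "b < length p" "p ! a = p ! b" for a b
        using that nth_eq_iff_index_eq[OF d, of a b] by simp
      then show ?thesis unfolding A_def B_def by blast
    qed
    moreover have "\<forall>a\<in>A. \<forall>b\<in>B. (a, b) \<notin> edges G"
    proof -
      have "(p ! a, p ! b) \<notin> edges G" if "a < j" "j < b" "b < length p" for a b
        using that by (simp add: path_list_edges_nth[OF p])
      then show ?thesis unfolding A_def B_def by blast
    qed
    ultimately show False
      using C[unfolded connected_in_def, THEN conjunct2] by (simp only: not_ex) metis
  qed
  with C show "C \<subseteq> verts G \<and> ?conv" by (simp add: connected_in_def)
next
  assume C: "C \<subseteq> verts G \<and> ?conv"
  have step: False
    if AB: "A \<union> B = C" "A \<inter> B = {}" "\<forall>a\<in>A. \<forall>b\<in>B. (a, b) \<notin> edges G"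
      and ik: "i < k" "k < length p" "p ! i \<in> A" "p ! k \<in> B" for A B i k
  proof -
    have "p ! (i + d) \<in> A" if "i + d \<le> k" for d
      using that
    proof (induction d)
      case 0
      then show ?case using ik by simp
    next
      case (Suc d)
      have "p ! (i + Suc d) \<in> C"
      proof (cases "i + Suc d = k")
        case True
        then show ?thesis using ik AB by auto
      next
        case False
        then show ?thesis
          using Suc.prems ik AB C[THEN conjunct2, rule_format, of i "i + Suc d" k] by auto
      qed
      moreover have "(p ! (i + d), p ! (i + Suc d)) \<in> edges G"
        using Suc.prems ik by (simp add: path_list_edges_nth[OF p])
      ultimately show ?case using Suc AB by auto
    qed
    from this[of "k - i"] show False using ik AB by auto
  qed
  have sym: "sym (edges G)" using p by (simp add: path_list_def is_graph_def)
  have False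
    if AB: "A \<noteq> {}" "B \<noteq> {}" "A \<union> B = C" "A \<inter> B = {}"
      "\<forall>a\<in>A. \<forall>b\<in>B. (a, b) \<notin> edges G" for A B
  proof -
    obtain a b where ab: "a \<in> A" "b \<in> B" using AB by blast
    moreover have "C \<subseteq> set p" using C p by (simp add: path_list_def)
    ultimately obtain i k where ik: "i < length p" "k < length p" "a = p ! i" "b = p ! k"
      using AB(3) by (metis in_set_conv_nth subsetD UnCI)
    \<comment> \<open>The fact \<open>step\<close> treats the order \<open>i < k\<close>; the
      opposite order follows by exchanging \<open>A\<close> and \<open>B\<close>, since edges are
      symmetric.\<close>
    have "\<forall>b\<in>B. \<forall>a\<in>A. (b, a) \<notin> edges G" using AB(5) sym by (meson symD)
    moreover have "B \<union> A = C" "B \<inter> A = {}" using AB by auto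
    ultimately have not_gt: "\<not> k < i" using step[of B A k i] ab ik by blast
    have "\<not> i < k" using step[OF AB(3-5), of i k] ab ik by blast
    then show False using not_gt AB(4) ab ik by (cases "i = k") auto
  qed
  then have "\<nexists>A B. A \<noteq> {} \<and> B \<noteq> {} \<and> A \<union> B = C \<and> A \<inter> B = {} \<and>
      (\<forall>a\<in>A. \<forall>b\<in>B. (a, b) \<notin> edges G)"
    by (simp only: not_ex) metis
  with C show "connected_in G C" unfolding connected_in_def by simp
qed

section \<open>Interval relations and their composition\<close>

text \<open>Both ends have one-vertex images: \<open>lo 0\<close> is at most
  \<open>hi 0 = 0\<close>, and \<open>hi m\<close> lies between \<open>lo m = n\<close> and
  \<open>n\<close>. The last bound puts the images of \<open>i\<close> and \<open>Suc i\<close>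
  together inside two consecutive vertices; this is edge preservation.\<close>

definition interval_steps :: "nat \<Rightarrow> nat \<Rightarrow> (nat \<Rightarrow> nat) \<Rightarrow> (nat \<Rightarrow> nat) \<Rightarrow> bool" where
  "interval_steps n m lo hi \<longleftrightarrow> hi 0 = 0 \<and> lo m = n \<and> (\<forall>i\<le>m. lo i \<le> hi i \<and> hi i \<le> n) \<and>
     (\<forall>i<m. lo i \<le> lo (Suc i) \<and> hi i \<le> hi (Suc i) \<and> hi (Suc i) \<le> Suc (lo i))"

definition interval_rel ::
    "'b list \<Rightarrow> 'a list \<Rightarrow> (nat \<Rightarrow> nat) \<Rightarrow> (nat \<Rightarrow> nat) \<Rightarrow> ('b \<times> 'a) set" where
  "interval_rel q p lo hi = {(q ! k, p ! i) |k i. i < length p \<and> lo i \<le> k \<and> k \<le> hi i}"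

lemma nondecreasing_upto:
  fixes f :: "nat \<Rightarrow> nat"
  assumes "\<And>i. i < m \<Longrightarrow> f i \<le> f (Suc i)" "i \<le> j" "j \<le> m"
  shows "f i \<le> f j"
  using assms(2,3)
proof (induction j rule: dec_induct)
  case (step j)
  then show ?case using assms(1)[of j] by simp
qed simp

lemma interval_steps_mono:
  assumes "interval_steps n m lo hi" "i \<le> j" "j \<le> m"
  shows "lo i \<le> lo j" "hi i \<le> hi j"
proof -
  show "lo i \<le> lo j"
    by (rule nondecreasing_upto[of m]) (use assms in \<open>simp_all add: interval_steps_def\<close>)
  show "hi i \<le> hi j"
    by (rule nondecreasing_upto[of m]) (use assms in \<open>simp_all add: interval_steps_def\<close>)
qed

lemma interval_steps_hi_le:
  assumes "interval_steps n m lo hi" "i \<le> m"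
  shows "hi i \<le> Suc (lo i)"
proof (cases "i = m")
  case False
  then have "i < m" using assms by simp
  then show ?thesis using assms unfolding interval_steps_def by (meson le_trans)
qed (use assms in \<open>auto simp: interval_steps_def intro: le_SucI\<close>)

text \<open>This supplies the one-vertex images that co-bijectivity demands. At the first index with
  \<open>k\<close> at most \<open>lo i\<close>, the predecessor has \<open>lo\<close> below
  \<open>k\<close>, so the step bound forces \<open>hi i\<close> down to \<open>k\<close>; at index
  0 the condition \<open>hi 0 = 0\<close> does so.\<close>

lemma interval_steps_singleton:
  assumes s: "interval_steps n m lo hi" and k: "k \<le> n"
  shows "\<exists>i\<le>m. lo i = k \<and> hi i = k"
proof -
  define i where "i = (LEAST i. k \<le> lo i)"
  have m: "k \<le> lo m" using s k by (simp add: interval_steps_def)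
  have i: "k \<le> lo i" "i \<le> m" unfolding i_def using m by (auto intro: LeastI Least_le)
  have le: "lo i \<le> hi i" using s i by (simp add: interval_steps_def)
  have "hi i \<le> k"
  proof (cases i)
    case 0
    then show ?thesis using s by (simp add: interval_steps_def)
  next
    case (Suc j)
    then have "lo j < k" using not_less_Least[of j "\<lambda>i. k \<le> lo i"] by (simp add: i_def)
    moreover have "hi i \<le> Suc (lo j)" using s Suc i by (simp add: interval_steps_def)
    ultimately show ?thesis by simp
  qed
  then show ?thesis using i le by (intro exI[of _ i]) simp
qed

lemma in_interval_rel_iff:
  assumes "distinct q" "distinct p" "length q = Suc n" "length p = Suc m"
    "interval_steps n m lo hi" "i \<le> m" "k \<le> n"
  shows "(q ! k, p ! i) \<in> interval_rel q p lo hi \<longleftrightarrow> lo i \<le> k \<and> k \<le> hi i"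
proof
  assume "(q ! k, p ! i) \<in> interval_rel q p lo hi"
  then obtain k' i' where *: "q ! k = q ! k'" "p ! i = p ! i'" "i' < length p" "lo i' \<le> k'" "k' \<le> hi i'"
    unfolding interval_rel_def by blast
  then have "i' = i" using assms by (simp add: nth_eq_iff_index_eq)
  moreover have "k' \<le> n" using * assms by (auto simp: interval_steps_def less_Suc_eq_le intro: le_trans)
  then have "k' = k" using * assms by (simp add: nth_eq_iff_index_eq)
  ultimately show "lo i \<le> k \<and> k \<le> hi i" using * by simp
next
  assume "lo i \<le> k \<and> k \<le> hi i"
  moreover have "i < length p" using assms by simp
  ultimately show "(q ! k, p ! i) \<in> interval_rel q p lo hi" unfolding interval_rel_def by blast
qed

lemma interval_rel_subset:
  assumes "length q = Suc n" "length p = Suc m" "interval_steps n m lo hi"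
  shows "interval_rel q p lo hi \<subseteq> set q \<times> set p"
proof -
  have "k < length q" if "i < length p" "k \<le> hi i" for i k
    using that assms by (auto simp: interval_steps_def less_Suc_eq_le intro: le_trans)
  then show ?thesis by (auto simp: interval_rel_def)
qed

lemma img_interval_rel:
  assumes "distinct p" "i < length p"
  shows "img (interval_rel q p lo hi) (p ! i) = (!) q ` {lo i..hi i}"
proof (intro equalityI subsetI)
  fix y assume "y \<in> img (interval_rel q p lo hi) (p ! i)"
  then obtain k i' where "y = q ! k" "p ! i = p ! i'" "i' < length p" "lo i' \<le> k" "k \<le> hi i'"
    by (auto simp: img_def interval_rel_def)
  moreover from this have "i' = i" using assms by (simp add: nth_eq_iff_index_eq)
  ultimately show "y \<in> (!) q ` {lo i..hi i}" by simp
next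
  fix y assume "y \<in> (!) q ` {lo i..hi i}"
  then obtain k where "y = q ! k" "lo i \<le> k" "k \<le> hi i" by auto
  then show "y \<in> img (interval_rel q p lo hi) (p ! i)"
    using assms(2) unfolding img_def interval_rel_def by blast
qed

text \<open>The image of \<open>j\<close> is a union of one or two intervals, those of
  \<open>a j\<close> and \<open>b j\<close>. The union is again an interval because consecutive
  images leave no gap.\<close>

lemma interval_rel_comp:
  assumes "distinct p" "length p = Suc m" "length l = Suc N"
    and s: "interval_steps n m lo hi" and t: "interval_steps m N a b"
  shows "interval_rel q p lo hi O interval_rel p l a b = interval_rel q l (lo \<circ> a) (hi \<circ> b)"
    (is "?L = ?R")
proof
  show "?L \<subseteq> ?R"
  proof
    fix x assume "x \<in> ?L"
    then obtain k i i' j where x: "x = (q ! k, l ! j)" "p ! i = p ! i'" "i < length p"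
      "lo i \<le> k" "k \<le> hi i" "j < length l" "a j \<le> i'" "i' \<le> b j"
      by (auto simp: interval_rel_def)
    have bm: "b j \<le> m" using t x assms by (simp add: interval_steps_def)
    then have "i' = i" using x assms by (simp add: nth_eq_iff_index_eq)
    then have "lo (a j) \<le> lo i" "hi i \<le> hi (b j)" using x bm interval_steps_mono[OF s] by auto
    then show "x \<in> ?R" using x unfolding interval_rel_def by force
  qed
  show "?R \<subseteq> ?L"
  proof
    fix x assume "x \<in> ?R"
    then obtain k j where x: "x = (q ! k, l ! j)" "j < length l" "lo (a j) \<le> k" "k \<le> hi (b j)"
      by (auto simp: interval_rel_def)
    have ab: "a j \<le> b j" "b j \<le> m" "b j \<le> Suc (a j)"
      using t x assms interval_steps_hi_le[OF t, of j] by (auto simp: interval_steps_def)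
    have "\<exists>i. a j \<le> i \<and> i \<le> b j \<and> lo i \<le> k \<and> k \<le> hi i"
    proof (cases "k \<le> hi (a j)")
      case False
      then have "b j = Suc (a j)" using ab x by (cases "b j = a j") auto
      \<comment> \<open>No gap: \<open>lo (b j)\<close> is at most \<open>hi (b j)\<close>, hence at
        most \<open>Suc (lo (a j))\<close>.\<close>
      moreover from this have "lo (b j) \<le> Suc (hi (a j))"
        using s ab unfolding interval_steps_def
        by (metis Suc_le_eq Suc_le_mono le_trans order.strict_implies_order)
      ultimately show ?thesis using False x ab by (intro exI[of _ "b j"]) auto
    qed (use x ab in auto)
    then obtain i where "a j \<le> i" "i \<le> b j" "lo i \<le> k" "k \<le> hi i" by blast
    moreover from this have "i < length p" using ab assms by simp
    ultimately show "x \<in> ?L" using x unfolding interval_rel_def by blast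
  qed
qed

section \<open>Morphisms of \<open>cat_A\<close> as interval relations\<close>

lemma interval_rel_mor_cat_A:
  assumes q: "path_list G q" "length q = Suc n" and p: "path_list H p" "length p = Suc m"
    and s: "interval_steps n m lo hi"
  shows "interval_rel q p lo hi \<in> mor cat_A G H"
proof -
  let ?R = "interval_rel q p lo hi"
  have dq: "distinct q" "set q = verts G" and dp: "distinct p" "set p = verts H"
    using q p by (auto simp: path_list_def)
  have sub: "?R \<subseteq> verts G \<times> verts H" using interval_rel_subset[OF q(2) p(2) s] dq dp by simp
  note mem = in_interval_rel_iff[OF dq(1) dp(1) q(2) p(2) s]
  have vp: "\<exists>i\<le>m. x = p ! i" if "x \<in> verts H" for x
    using that dp p(2) by (metis in_set_conv_nth less_Suc_eq_le)
  have vq: "\<exists>i\<le>n. x = q ! i" if "x \<in> verts G" for x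
    using that dq q(2) by (metis in_set_conv_nth less_Suc_eq_le)
  have "monotone_rel G H ?R"
    unfolding monotone_rel_def
  proof (intro allI impI)
    fix C assume "connected_in G C"
    then have C: "C \<subseteq> verts G"
      "\<And>i j k. i < j \<Longrightarrow> j < k \<Longrightarrow> k < length q \<Longrightarrow> q ! i \<in> C \<Longrightarrow> q ! k \<in> C \<Longrightarrow> q ! j \<in> C"
      using connected_in_path_iff[OF q(1)] by blast+
    have pre: "p ! i \<in> ?R `` C \<longleftrightarrow> (\<exists>k\<le>n. lo i \<le> k \<and> k \<le> hi i \<and> q ! k \<in> C)"
      if "i \<le> m" for i
      using vq C(1) mem[OF that] by (auto simp: Image_iff) blast
    show "connected_in H (?R `` C)"
      unfolding connected_in_path_iff[OF p(1)]
    proof (intro conjI allI impI)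
      fix i j k
      assume ijk: "i < j" "j < k" "k < length p" "p ! i \<in> ?R `` C" "p ! k \<in> ?R `` C"
      obtain y where y: "y \<le> n" "lo i \<le> y" "y \<le> hi i" "q ! y \<in> C" using ijk p(2) pre[of i] by auto
      obtain z where z: "z \<le> n" "lo k \<le> z" "z \<le> hi k" "q ! z \<in> C" using ijk p(2) pre[of k] by auto
      have mono: "hi i \<le> hi j" "lo j \<le> lo k" "lo j \<le> hi j" "hi j \<le> n"
        using interval_steps_mono[OF s] s ijk p(2) by (auto simp: interval_steps_def)
      \<comment> \<open>Either \<open>t\<close> is \<open>y\<close>, or it is \<open>lo j\<close>,
        which lies above \<open>y\<close> and is at most \<open>lo k\<close> and so at most
        \<open>z\<close>; convexity of \<open>C\<close> then applies. Since \<open>y\<close> is at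
        most \<open>hi i\<close>, and so at most \<open>hi j\<close>, the index \<open>t\<close>
        stays in the interval of \<open>j\<close>.\<close>
      define t where "t = max y (lo j)"
      have "q ! t \<in> C"
      proof (cases "t = y \<or> t = z")
        case False
        then have "y < t" "t < z" using mono z by (auto simp: t_def)
        then show ?thesis using C(2)[of y t z] y z q(2) by simp
      qed (use y z in auto)
      moreover have "t \<le> n" "lo j \<le> t" "t \<le> hi j" using mono y by (auto simp: t_def)
      ultimately show "p ! j \<in> ?R `` C" using ijk p(2) pre[of j] by auto
    qed (use sub in auto)
  qed
  moreover have "co_bijective G H ?R"
    unfolding co_bijective_def
  proof (intro conjI ballI)
    fix x assume "x \<in> verts H"
    then obtain i where "i \<le> m" "x = p ! i" using vp by blast
    then show "img ?R x \<noteq> {}"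
      using s p(2) by (auto simp: img_interval_rel[OF dp(1)] interval_steps_def)
  next
    fix y assume "y \<in> verts G"
    then obtain k where k: "k \<le> n" "y = q ! k" using vq by blast
    then obtain i where i: "i \<le> m" "lo i = k" "hi i = k"
      using interval_steps_singleton[OF s] by blast
    have "img ?R (p ! i) = {y}" using i k p(2) by (simp add: img_interval_rel[OF dp(1)])
    moreover have "p ! i \<in> verts H" unfolding dp(2)[symmetric] using i p(2) by simp
    ultimately show "\<exists>x\<in>verts H. img ?R x = {y}" by blast
  qed
  moreover have "edge_preserving G H ?R"
    unfolding edge_preserving_def
  proof (intro allI impI)
    \<comment> \<open>Monotonicity of \<open>hi\<close> covers the indices \<open>i'\<close> up to
      \<open>i\<close>, so the fact can be used below in both orders of the two adjacent
      vertices.\<close>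
    have adj: "hi i' \<le> Suc (lo i)" if "i' \<le> Suc i" "i \<le> m" "i' \<le> m" for i i'
    proof (cases "i' = Suc i")
      case True
      then show ?thesis using s that by (simp add: interval_steps_def)
    next
      case False
      then show ?thesis
        using interval_steps_mono(2)[OF s, of i' i] interval_steps_hi_le[OF s, of i] that by simp
    qed
    fix y x y' x'
    assume *: "(y, x) \<in> ?R \<and> (y', x') \<in> ?R \<and> (x, x') \<in> edges H"
    then obtain k i k' i' where
      yx: "y = q ! k" "x = p ! i" "i \<le> m" "lo i \<le> k" "k \<le> hi i"
        "y' = q ! k'" "x' = p ! i'" "i' \<le> m" "lo i' \<le> k'" "k' \<le> hi i'"
      using p(2) by (auto simp: interval_rel_def)
    then have "i \<le> Suc i'" "i' \<le> Suc i"
      using * p(2) by (simp_all add: path_list_edges_nth[OF p(1)])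
    then have "hi i \<le> Suc (lo i')" "hi i' \<le> Suc (lo i)" using adj yx by auto
    moreover have "hi i \<le> n" "hi i' \<le> n" using s yx by (auto simp: interval_steps_def)
    ultimately show "(y, y') \<in> edges G"
      using yx q(2) by (auto simp: path_list_edges_nth[OF q(1)])
  qed
  ultimately show ?thesis using sub by (simp add: cat_A_def)
qed

text \<open>Co-bijectivity provides \<open>c\<close> and \<open>d\<close>, whose images are exactly
  the two end vertices of \<open>G\<close>; \<open>c \<le> d\<close> says that \<open>p\<close> runs
  in the direction of \<open>q\<close>. Edge preservation bounds the width of images, and
  monotonicity of \<open>R\<close> makes preimages of intervals convex.\<close>

lemma mor_cat_A_oriented:
  assumes q: "path_list G q" "length q = Suc n" and p: "path_list H p" "length p = Suc m"
    and R: "R \<in> mor cat_A G H"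
    and c: "c \<le> m" "img R (p ! c) = {q ! 0}" and d: "d \<le> m" "img R (p ! d) = {q ! n}"
    and cd: "c \<le> d"
  shows "\<exists>lo hi. interval_steps n m lo hi \<and> R = interval_rel q p lo hi"
proof -
  have dq: "distinct q" "set q = verts G" and dp: "distinct p" "set p = verts H"
    using q p by (auto simp: path_list_def)
  have R: "R \<subseteq> verts G \<times> verts H" "monotone_rel G H R" "co_bijective G H R"
    "edge_preserving G H R"
    using R by (simp_all add: cat_A_def)
  have vp: "\<exists>i\<le>m. x = p ! i" if "x \<in> verts H" for x
    using that dp p(2) by (metis in_set_conv_nth less_Suc_eq_le)
  have vq: "\<exists>i\<le>n. x = q ! i" if "x \<in> verts G" for x
    using that dq q(2) by (metis in_set_conv_nth less_Suc_eq_le)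
  define S where "S i = {k. k \<le> n \<and> (q ! k, p ! i) \<in> R}" for i
  define lo where "lo i = Min (S i)" for i
  define hi where "hi i = Max (S i)" for i
  have fin: "finite (S i)" for i by (auto simp: S_def)
  have ne: "S i \<noteq> {}" if "i \<le> m" for i
  proof -
    have "p ! i \<in> verts H" unfolding dp(2)[symmetric] using that p(2) by simp
    then obtain y where "(y, p ! i) \<in> R" using R(3) unfolding co_bijective_def img_def by blast
    moreover from this have "y \<in> verts G" using R(1) by blast
    then obtain k where "k \<le> n" "y = q ! k" using vq by blast
    ultimately show ?thesis unfolding S_def by blast
  qed
  have lohi: "lo i \<in> S i" "hi i \<in> S i" if "i \<le> m" for i
    using fin ne[OF that] by (auto simp: lo_def hi_def)
  have bounds: "lo i \<le> k" "k \<le> hi i" if "k \<in> S i" for i k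
    using fin that by (auto simp: lo_def hi_def)
  \<comment> \<open>For \<open>i = i'\<close> this uses the loops of \<open>H\<close> and bounds the
    width of one image; for neighbours it gives the step bound.\<close>
  have adj: "k \<le> Suc k'"
    if "k \<in> S i" "k' \<in> S i'" "i \<le> m" "i' \<le> m" "i' \<le> Suc i" "i \<le> Suc i'" for i i' k k'
  proof -
    have "(p ! i, p ! i') \<in> edges H" using that p(2) by (simp add: path_list_edges_nth[OF p(1)])
    then have "(q ! k, q ! k') \<in> edges G"
      using R(4) that unfolding edge_preserving_def S_def by blast
    then show ?thesis using that q(2) by (simp add: path_list_edges_nth[OF q(1)] S_def)
  qed
  \<comment> \<open>Monotonicity of \<open>R\<close> is applied to the interval of \<open>q\<close>
    from \<open>a\<close> to \<open>b\<close>: its preimage is connected, so no index between two of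
    its members is missing.\<close>
  have conv: "\<exists>k\<in>S j. a \<le> k \<and> k \<le> b"
    if ijl: "i < j" "j < l" "l \<le> m" and e: "\<exists>k\<in>S i. a \<le> k \<and> k \<le> b" "\<exists>k\<in>S l. a \<le> k \<and> k \<le> b"
    for i j l a b
  proof -
    define C where "C = {q ! k |k. k \<le> n \<and> a \<le> k \<and> k \<le> b}"
    have C: "q ! k \<in> C \<longleftrightarrow> a \<le> k \<and> k \<le> b" if "k \<le> n" for k
      using that q(2) dq(1) by (auto simp: C_def nth_eq_iff_index_eq)
    have CG: "C \<subseteq> verts G" unfolding dq(2)[symmetric] using q(2) by (auto simp: C_def)
    have "q ! j \<in> C" if "i < j" "j < k" "k < length q" "q ! i \<in> C" "q ! k \<in> C" for i j k
      using that q(2) C[of i] C[of j] C[of k] by simp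
    then have "connected_in G C"
      using CG unfolding connected_in_path_iff[OF q(1)] by blast
    then have "connected_in H (R `` C)" using R(2) by (simp add: monotone_rel_def)
    then have "p ! i \<in> R `` C \<Longrightarrow> p ! l \<in> R `` C \<Longrightarrow> p ! j \<in> R `` C"
      using ijl p(2) unfolding connected_in_path_iff[OF p(1)] by (simp add: less_Suc_eq_le)
    moreover have "p ! i \<in> R `` C \<longleftrightarrow> (\<exists>k\<in>S i. a \<le> k \<and> k \<le> b)" for i
      unfolding C_def S_def by blast
    ultimately show ?thesis using e by simp
  qed
  \<comment> \<open>Intervals reaching down to 0 detect \<open>lo\<close>, and intervals reaching up
    to \<open>n\<close> detect \<open>hi\<close>.\<close>
  have down: "lo j \<le> k"
    if ijl: "i < j" "j < l" "l \<le> m" and "lo i \<le> k" "lo l \<le> k" for i j l k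
  proof -
    have "\<exists>x\<in>S i. 0 \<le> x \<and> x \<le> k" "\<exists>x\<in>S l. 0 \<le> x \<and> x \<le> k"
      using that lohi(1)[of i] lohi(1)[of l] by auto
    then obtain x where "x \<in> S j" "x \<le> k" using conv[OF ijl] by meson
    then show ?thesis using bounds(1)[of x j] by simp
  qed
  have up: "k \<le> hi j"
    if ijl: "i < j" "j < l" "l \<le> m" and "k \<le> hi i" "k \<le> hi l" for i j l k
  proof -
    have S: "hi i \<in> S i" "hi l \<in> S l" using that lohi by simp_all
    then have "hi i \<le> n" "hi l \<le> n" by (simp_all add: S_def)
    then have "\<exists>x\<in>S i. k \<le> x \<and> x \<le> n" "\<exists>x\<in>S l. k \<le> x \<and> x \<le> n"
      using that S by auto
    then obtain x where "x \<in> S j" "k \<le> x" using conv[OF ijl] by meson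
    then show ?thesis using bounds(2)[of x j] by simp
  qed
  have single: "S i = {k}" if "img R (p ! i) = {q ! k}" "k \<le> n" for i k
  proof -
    have "(q ! k', p ! i) \<in> R \<longleftrightarrow> k' = k" if "k' \<le> n" for k'
      using \<open>img R (p ! i) = {q ! k}\<close> \<open>k \<le> n\<close> that q(2) dq(1)
      by (auto simp: img_def set_eq_iff nth_eq_iff_index_eq)
    then show ?thesis using \<open>k \<le> n\<close> by (auto simp: S_def)
  qed
  have c': "lo c = 0" "hi c = 0" using single[OF c(2)] by (auto simp: lo_def hi_def)
  have d': "lo d = n" "hi d = n" using single[OF d(2)] by (auto simp: lo_def hi_def)
  have lo_n: "lo i \<le> n" "hi i \<le> n" if "i \<le> m" for i using lohi[OF that] by (auto simp: S_def)
  have lo_le_hi: "lo i \<le> hi i" if "i \<le> m" for i using lohi[OF that] bounds by blast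
  have hi_le: "hi i \<le> Suc (lo i)" if "i \<le> m" for i
    using adj[OF lohi(2)[OF that] lohi(1)[OF that]] that by simp
  have cd': "c < d" if "0 < n" using c' d' cd that by (cases "c = d") auto
  \<comment> \<open>The preimages \<open>{i. lo i \<le> k}\<close> and \<open>{i. k < hi i}\<close> are intervals that cover all vertices. For
    \<open>k < n\<close> the first contains \<open>c\<close> but not \<open>d\<close> and the second \<open>d\<close> but not \<open>c\<close>, so \<open>c < d\<close> makes the
    first an initial and the second a final segment.\<close>
  have lo_mono: "lo i \<le> lo j" if ij: "i \<le> j" "j \<le> m" for i j
  proof (rule ccontr)
    assume not: "\<not> lo i \<le> lo j"
    then have lt: "lo j < n" "i < j" "c < d" using lo_n[of i] ij cd' by (auto simp: le_less)
    show False
    proof (cases c i rule: linorder_cases)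
      case less
      then show False using down[of c i j "lo j"] lt ij c' not by simp
    next
      case equal
      then show False using c' not by simp
    next
      case greater
      then show False
        using up[of i c d "Suc (lo j)"] lt c' d' d(1) not lo_le_hi[of i] ij by simp
    qed
  qed
  have hi_mono: "hi i \<le> hi j" if ij: "i \<le> j" "j \<le> m" for i j
  proof (rule ccontr)
    assume not: "\<not> hi i \<le> hi j"
    then have lt: "0 < hi i" "i < j" "c < d" "hi i \<le> n" "hi j < n"
      using lo_n[of i] ij cd' by (auto simp: le_less)
    show False
    proof (cases j d rule: linorder_cases)
      case less
      then show False using up[of i j d "hi i"] lt d' d(1) not by simp
    next
      case equal
      then show False using d' lt not by simp
    next
      case greater
      then show False
        using down[of c d j "hi j"] lt c' d' not lo_le_hi[of j] ij by simp
    qed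
  qed
  have "interval_steps n m lo hi"
    unfolding interval_steps_def
  proof (intro conjI allI impI)
    show "hi 0 = 0" using hi_mono[of 0 c] c c' by simp
    show "lo m = n" using lo_mono[of d m] d d' lo_n[of m] by simp
    fix i assume i: "i < m"
    show "lo i \<le> lo (Suc i)" "hi i \<le> hi (Suc i)" using i lo_mono hi_mono by auto
    show "hi (Suc i) \<le> Suc (lo i)" using adj[OF lohi(2)[of "Suc i"] lohi(1)[of i]] i by simp
  qed (use lo_le_hi lo_n in auto)
  moreover have "R = interval_rel q p lo hi"
  proof (intro set_eqI)
    fix z :: "'a \<times> 'a"
    \<comment> \<open>Since \<open>hi i\<close> is at most \<open>Suc (lo i)\<close>, the set
      \<open>S i\<close> has no elements other than its minimum and maximum, and there is nothing
      between these.\<close>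
    have *: "k \<in> S i \<longleftrightarrow> lo i \<le> k \<and> k \<le> hi i" if "i \<le> m" for i k
      using lohi[OF that] bounds hi_le[OF that] le_Suc_eq by (metis le_antisym)
    have "z \<in> R \<longleftrightarrow> (\<exists>i\<le>m. \<exists>k. z = (q ! k, p ! i) \<and> k \<in> S i)"
      using R(1) vp vq by (cases z) (auto simp: S_def, blast)
    also have "\<dots> \<longleftrightarrow> z \<in> interval_rel q p lo hi"
      using * p(2) by (auto simp: interval_rel_def less_Suc_eq_le)
    finally show "z \<in> R \<longleftrightarrow> z \<in> interval_rel q p lo hi" .
  qed
  ultimately show ?thesis by blast
qed

text \<open>The listing \<open>q\<close> of the codomain is given and only the listing of the domain
  is chosen, by reversal if \<open>d < c\<close>. Two morphisms into \<open>G\<close> can therefore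
  share \<open>q\<close>.\<close>

lemma mor_cat_A_interval_rel:
  assumes q: "path_list G q" "length q = Suc n" and H: "is_path H" and R: "R \<in> mor cat_A G H"
  obtains p m lo hi where "path_list H p" "length p = Suc m" "interval_steps n m lo hi"
    "R = interval_rel q p lo hi"
proof -
  obtain p m where p: "path_list H p" "length p = Suc m"
    using H is_path_iff_path_list path_list_length by blast
  have dp: "set p = verts H" using p by (simp add: path_list_def)
  have "\<exists>i\<le>m. img R (p ! i) = {q ! k}" if "k \<le> n" for k
  proof -
    have "q ! k \<in> verts G" using that q by (auto simp: path_list_def)
    then obtain x where "x \<in> verts H" "img R x = {q ! k}"
      using R by (auto simp: cat_A_def co_bijective_def)
    then show ?thesis using dp p(2) by (metis in_set_conv_nth less_Suc_eq_le)
  qed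
  then obtain c d where c: "c \<le> m" "img R (p ! c) = {q ! 0}" and d: "d \<le> m" "img R (p ! d) = {q ! n}"
    by (meson le0 order_refl)
  show ?thesis
  proof (cases "c \<le> d")
    case True
    then show ?thesis using mor_cat_A_oriented[OF q p R c d] that p by blast
  next
    case False
    have p': "path_list H (rev p)" "length (rev p) = Suc m" using p path_list_rev by auto
    have "img R (rev p ! (m - c)) = {q ! 0}" "img R (rev p ! (m - d)) = {q ! n}"
      using c d p(2) by (simp_all add: rev_nth)
    moreover have "m - c \<le> m - d" using False by arith
    ultimately obtain lo hi where "interval_steps n m lo hi" "R = interval_rel q (rev p) lo hi"
      using mor_cat_A_oriented[OF q p' R, of "m - c" "m - d"] by auto
    then show ?thesis using that[OF p'] by blast
  qed
qed

lemma function_rel_interval_rel: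
  assumes "path_list G q" "length q = Suc n" and p: "path_list H p" "length p = Suc m"
    and "interval_steps n m lo hi"
  shows "function_rel H (interval_rel q p lo hi) \<longleftrightarrow> (\<forall>i\<le>m. lo i = hi i)"
proof -
  have dq: "distinct q" and dp: "distinct p" "set p = verts H"
    using assms by (auto simp: path_list_def)
  have *: "(\<exists>y. img (interval_rel q p lo hi) (p ! i) = {y}) \<longleftrightarrow> lo i = hi i" if "i \<le> m" for i
  proof -
    have le: "lo i \<le> hi i" "hi i \<le> n" using assms that by (auto simp: interval_steps_def)
    have "img (interval_rel q p lo hi) (p ! i) = (!) q ` {lo i..hi i}"
      using that p dp by (simp add: img_interval_rel)
    moreover have "lo i = hi i" if "(!) q ` {lo i..hi i} = {y}" for y
    proof -
      have "q ! lo i = y" "q ! hi i = y" using that le by auto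
      then show ?thesis using dq le assms(2) nth_eq_iff_index_eq[OF dq, of "lo i" "hi i"] by simp
    qed
    ultimately show ?thesis by auto
  qed
  have "function_rel H (interval_rel q p lo hi) \<longleftrightarrow>
      (\<forall>i\<le>m. \<exists>y. img (interval_rel q p lo hi) (p ! i) = {y})"
    unfolding function_rel_def dp(2)[symmetric] all_set_conv_all_nth p(2) less_Suc_eq_le ..
  then show ?thesis using * by simp
qed

section \<open>Common walks of unit-step maps\<close>

text \<open>On the indices up to \<open>m\<close> these are exactly the nondecreasing surjections
  from \<open>{0..m}\<close> onto \<open>{0..n}\<close>.\<close>

definition unit_steps :: "nat \<Rightarrow> nat \<Rightarrow> (nat \<Rightarrow> nat) \<Rightarrow> bool" where
  "unit_steps n m f \<longleftrightarrow>
     f 0 = 0 \<and> f m = n \<and> (\<forall>i<m. f i \<le> f (Suc i) \<and> f (Suc i) \<le> Suc (f i))"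

lemma unit_steps_mono: "unit_steps n m f \<Longrightarrow> i \<le> j \<Longrightarrow> j \<le> m \<Longrightarrow> f i \<le> f j"
  by (rule nondecreasing_upto[of m]) (simp_all add: unit_steps_def)

lemma unit_steps_le: "unit_steps n m f \<Longrightarrow> i \<le> m \<Longrightarrow> f i \<le> n"
  using unit_steps_mono[of n m f i m] by (simp add: unit_steps_def)

lemma unit_steps_restrict: "unit_steps n (Suc m) f \<Longrightarrow> unit_steps (f m) m f"
  by (simp add: unit_steps_def)

lemma unit_steps_extend:
  "unit_steps m N u \<Longrightarrow> m \<le> m' \<Longrightarrow> m' \<le> Suc m \<Longrightarrow> unit_steps m' (Suc N) (u(Suc N := m'))"
  by (auto simp: unit_steps_def less_Suc_eq)

text \<open>Induction from the far end: if one map is constant on its last step, drop that step;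
  otherwise both maps rise by one there, so dropping both steps leaves maps with the same
  endpoint.\<close>

lemma common_walk:
  assumes "unit_steps n m f" "unit_steps n p g"
  shows "\<exists>N u v. unit_steps m N u \<and> unit_steps p N v \<and> (\<forall>j\<le>N. f (u j) = g (v j))"
  using assms
proof (induction "m + p" arbitrary: n m p rule: less_induct)
  case less
  \<comment> \<open>A walk for the shortened maps ends at \<open>(m', p')\<close>; append the pair
    \<open>(m, p)\<close>, at which both maps take the value \<open>n\<close>.\<close>
  have extend: ?case
    if f: "unit_steps n' m' f" "m' \<le> m" "m \<le> Suc m'" and g: "unit_steps n' p' g" "p' \<le> p" "p \<le> Suc p'"
      and lt: "m' + p' < m + p" for n' m' p'
  proof -
    obtain N u v where uv: "unit_steps m' N u" "unit_steps p' N v" "\<forall>j\<le>N. f (u j) = g (v j)"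
      using less.hyps[OF lt f(1) g(1)] by blast
    have "f m = g p" using less.prems by (simp add: unit_steps_def)
    then have "\<forall>j\<le>Suc N. f ((u(Suc N := m)) j) = g ((v(Suc N := p)) j)"
      using uv(3) by (simp add: le_Suc_eq)
    then show ?thesis using unit_steps_extend uv f g by blast
  qed
  consider (left) m' where "m = Suc m'" "f m' = n" | (right) p' where "p = Suc p'" "g p' = n"
    | (both) m' p' where "m = Suc m'" "p = Suc p'" "Suc (f m') = n" "Suc (g p') = n"
    | (none) "m = 0" "p = 0"
  proof -
    have F: "f m' = n \<or> Suc (f m') = n" if "m = Suc m'" for m'
      using less.prems(1) that unfolding unit_steps_def by fastforce
    have G: "g p' = n \<or> Suc (g p') = n" if "p = Suc p'" for p'
      using less.prems(2) that unfolding unit_steps_def by fastforce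
    have "m = 0 \<or> p = 0 \<Longrightarrow> n = 0" using less.prems by (auto simp: unit_steps_def)
    then show thesis using F G that by (cases m; cases p) auto
  qed
  then show ?case
  proof cases
    case left
    then show ?thesis using extend[of n m' p] less.prems unit_steps_restrict by force
  next
    case right
    then show ?thesis using extend[of n m p'] less.prems unit_steps_restrict by force
  next
    case both
    then show ?thesis using extend[of "f m'" m' p'] less.prems unit_steps_restrict
      by (metis Suc_inject add_less_mono le_Suc_eq lessI order_refl)
  next
    case none
    then show ?thesis using less.prems
      by (intro exI[of _ 0] exI[of _ "\<lambda>_. 0"]) (simp add: unit_steps_def)
  qed
qed

section \<open>Encoding of intervals by vertices and edges\<close>

lemma interval_steps_function: "unit_steps n m f \<Longrightarrow> interval_steps n m f f"
  by (auto simp: unit_steps_le interval_steps_def) (auto simp: unit_steps_def)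

lemma unit_steps_of_function:
  "interval_steps n m lo hi \<Longrightarrow> \<forall>i\<le>m. lo i = hi i \<Longrightarrow> unit_steps n m lo"
  by (auto simp: interval_steps_def unit_steps_def)

text \<open>The value \<open>2 * k\<close> decodes to the vertex \<open>k\<close> and
  \<open>2 * k + 1\<close> to the pair \<open>k\<close>, \<open>k + 1\<close>. Only values are
  decoded: a position \<open>j\<close> of either parity becomes one vertex of the domain.\<close>

lemma interval_steps_decode:
  assumes "unit_steps (2 * n) m u"
  shows "interval_steps n m (\<lambda>j. u j div 2) (\<lambda>j. Suc (u j) div 2)"
proof -
  have "u j \<le> 2 * n" if "j \<le> m" for j using assms that unit_steps_le by blast
  then have "Suc (u j) div 2 \<le> n" if "j \<le> m" for j using that by fastforce
  moreover have "Suc (u (Suc j)) div 2 \<le> Suc (u j div 2)" if "j < m" for j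
    using assms that unfolding unit_steps_def by (metis div2_Suc_Suc div_le_mono Suc_le_mono)
  ultimately show ?thesis using assms by (auto simp: interval_steps_def unit_steps_def intro: div_le_mono)
qed

text \<open>An interval of one or two vertices is coded by the sum of its ends. At
  \<open>u = 2 * i\<close> this codes the image of the vertex \<open>i\<close>, and at
  \<open>u = 2 * i + 1\<close> the union of the images of \<open>i\<close> and
  \<open>i + 1\<close>.\<close>

definition encode_steps :: "(nat \<Rightarrow> nat) \<Rightarrow> (nat \<Rightarrow> nat) \<Rightarrow> nat \<Rightarrow> nat" where
  "encode_steps lo hi u = lo (u div 2) + hi (Suc u div 2)"

lemma encode_steps_even_odd:
  "encode_steps lo hi (2 * i) = lo i + hi i"
  "encode_steps lo hi (Suc (2 * i)) = lo i + hi (Suc i)"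
  by (simp_all add: encode_steps_def)

text \<open>From \<open>2 * i\<close> to \<open>2 * i + 1\<close> only the \<open>hi\<close> summand
  changes, and in the next step only the \<open>lo\<close> summand; either change is at most one
  because \<open>hi (Suc i)\<close> is at most \<open>Suc (lo i)\<close>.\<close>

lemma unit_steps_encode:
  assumes s: "interval_steps n m lo hi"
  shows "unit_steps (2 * n) (2 * m) (encode_steps lo hi)"
  unfolding unit_steps_def
proof (intro conjI allI impI)
  have "lo 0 = 0" using s unfolding interval_steps_def by (metis le0 le_zero_eq)
  then show "encode_steps lo hi 0 = 0" using s by (simp add: encode_steps_def interval_steps_def)
  have "hi m = n" using s unfolding interval_steps_def by (metis le_antisym order_refl)
  then show "encode_steps lo hi (2 * m) = 2 * n"
    using s by (simp add: encode_steps_even_odd interval_steps_def)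
  fix u assume u: "u < 2 * m"
  define i where "i = u div 2"
  have "i < m" using u by (simp add: i_def)
  then have "lo i \<le> lo (Suc i)" "hi i \<le> hi (Suc i)" "hi (Suc i) \<le> Suc (lo i)"
    "lo i \<le> hi i" "lo (Suc i) \<le> hi (Suc i)"
    using s by (auto simp: interval_steps_def)
  moreover have "u = 2 * i \<or> u = Suc (2 * i)" by (auto simp: i_def)
  moreover have "Suc (Suc (2 * i)) = 2 * Suc i" by simp
  ultimately show "encode_steps lo hi u \<le> encode_steps lo hi (Suc u)"
    "encode_steps lo hi (Suc u) \<le> Suc (encode_steps lo hi u)"
    using encode_steps_even_odd[of lo hi i] encode_steps_even_odd(1)[of lo hi "Suc i"] by auto
qed

text \<open>If \<open>x \<le> y \<le> Suc x\<close>, then half of \<open>x + y\<close> rounds down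
  to \<open>x\<close> and up to \<open>y\<close>. Together with \<open>interval_rel_comp\<close>,
  this turns composition of relations into composition of encoded maps.\<close>

lemma decode_encode_steps:
  assumes s: "interval_steps n m lo hi" and u: "u \<le> 2 * m"
  shows "encode_steps lo hi u div 2 = lo (u div 2)"
    "Suc (encode_steps lo hi u) div 2 = hi (Suc u div 2)"
proof -
  define i where "i = u div 2"
  \<comment> \<open>An odd \<open>u\<close> is strictly below \<open>2 * m\<close>, so the edge from
    \<open>i\<close> to \<open>Suc i\<close> lies in the path.\<close>
  consider "u = 2 * i" "i \<le> m" | "u = Suc (2 * i)" "i < m"
    using u by (fastforce simp: i_def)
  then have "lo i \<le> hi (Suc u div 2) \<and> hi (Suc u div 2) \<le> Suc (lo i)"
  proof cases
    case 1
    then show ?thesis using s interval_steps_hi_le[OF s, of i] by (simp add: interval_steps_def)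
  next
    case 2
    then show ?thesis using s unfolding interval_steps_def by (auto intro: le_trans)
  qed
  then show "encode_steps lo hi u div 2 = lo (u div 2)"
    "Suc (encode_steps lo hi u) div 2 = hi (Suc u div 2)"
    unfolding encode_steps_def i_def[symmetric] by linarith+
qed

lemma interval_rel_cong:
  assumes "\<And>i. i < length p \<Longrightarrow> lo i = lo' i" "\<And>i. i < length p \<Longrightarrow> hi i = hi' i"
  shows "interval_rel q p lo hi = interval_rel q p lo' hi'"
  using assms unfolding interval_rel_def by (metis (no_types, lifting))

section \<open>Construction of the amalgams\<close>

lemma ex_path_list:
  "\<exists>(J :: 'a::infinite graph) l. path_list J l \<and> length l = Suc N"
proof -
  obtain X :: "'a set" where X: "finite X" "card X = Suc N"
    using infinite_arbitrarily_large infinite_UNIV by blast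
  then obtain l where l: "set l = X" "distinct l" using finite_distinct_list by blast
  then have len: "length l = Suc N" using X distinct_card by fastforce
  define J where "J = \<lparr>verts = set l,
    edges = {(l ! i, l ! j) |i j. i < length l \<and> j < length l \<and> i \<le> Suc j \<and> j \<le> Suc i}\<rparr>"
  have "refl_on (set l) (edges J)" by (force simp: refl_on_def J_def in_set_conv_nth)
  then have "is_graph J"
    using len unfolding is_graph_def by (auto simp: J_def sym_def)
  then have "path_list J l"
    using l by (auto simp: path_list_def J_def nth_eq_iff_index_eq)
  with len show ?thesis by blast
qed

lemma has_amalgamation_cat_A: "has_amalgamation (cat_A :: 'a::infinite rel_cat)"
  unfolding has_amalgamation_def
proof (intro ballI)
  fix G H I :: "'a graph" and R Q
  assume "G \<in> obj cat_A" "H \<in> obj cat_A" "I \<in> obj cat_A"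
    and R: "R \<in> mor cat_A G H" and Q: "Q \<in> mor cat_A G I"
  then have GHI: "is_path G" "is_path H" "is_path I" by (simp_all add: cat_A_def)
  obtain q n where q: "path_list G q" "length q = Suc n"
    using GHI(1) is_path_iff_path_list path_list_length by blast
  obtain p m lo hi where p: "path_list H p" "length p = Suc m" and s: "interval_steps n m lo hi"
    and Req: "R = interval_rel q p lo hi"
    using mor_cat_A_interval_rel[OF q GHI(2) R] .
  obtain p' m' lo' hi' where p': "path_list I p'" "length p' = Suc m'"
    and s': "interval_steps n m' lo' hi'" and Qeq: "Q = interval_rel q p' lo' hi'"
    using mor_cat_A_interval_rel[OF q GHI(3) Q] .
  obtain N u v where u: "unit_steps (2 * m) N u" and v: "unit_steps (2 * m') N v"
    and uv: "\<forall>j\<le>N. encode_steps lo hi (u j) = encode_steps lo' hi' (v j)"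
    using common_walk[OF unit_steps_encode[OF s] unit_steps_encode[OF s']] by blast
  \<comment> \<open>The amalgam has one vertex for each of the \<open>N + 1\<close> positions of the
    common walk.\<close>
  obtain J :: "'a graph" and l where l: "path_list J l" "length l = Suc N"
    using ex_path_list by blast
  let ?R' = "interval_rel p l (\<lambda>j. u j div 2) (\<lambda>j. Suc (u j) div 2)"
  let ?Q' = "interval_rel p' l (\<lambda>j. v j div 2) (\<lambda>j. Suc (v j) div 2)"
  have dp: "distinct p" "distinct p'" using p p' by (auto simp: path_list_def)
  \<comment> \<open>Both composites are decodings of the same sequence of codes along the
    walk.\<close>
  have "R O ?R' = interval_rel q l (\<lambda>j. encode_steps lo hi (u j) div 2)
      (\<lambda>j. Suc (encode_steps lo hi (u j)) div 2)"
    unfolding Req interval_rel_comp[OF dp(1) p(2) l(2) s interval_steps_decode[OF u]]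
    by (rule interval_rel_cong) (simp_all add: decode_encode_steps[OF s] unit_steps_le[OF u] l(2))
  also have "\<dots> = interval_rel q l (\<lambda>j. encode_steps lo' hi' (v j) div 2)
      (\<lambda>j. Suc (encode_steps lo' hi' (v j)) div 2)"
    using uv l(2) by (intro interval_rel_cong) auto
  also have "\<dots> = Q O ?Q'"
    unfolding Qeq interval_rel_comp[OF dp(2) p'(2) l(2) s' interval_steps_decode[OF v]]
    by (rule interval_rel_cong) (simp_all add: decode_encode_steps[OF s'] unit_steps_le[OF v] l(2))
  finally have "R O ?R' = Q O ?Q'" .
  moreover have "?R' \<in> mor cat_A H J" "?Q' \<in> mor cat_A I J"
    using interval_rel_mor_cat_A[OF p l interval_steps_decode[OF u]]
      interval_rel_mor_cat_A[OF p' l interval_steps_decode[OF v]] by auto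
  moreover have "J \<in> obj cat_A" using l is_path_iff_path_list by (auto simp: cat_A_def)
  ultimately show "\<exists>J\<in>obj cat_A. \<exists>R'\<in>mor cat_A H J. \<exists>Q'\<in>mor cat_A I J. R O R' = Q O Q'"
    by blast
qed

text \<open>The legs built for \<open>cat_A\<close> need not be functions, since an odd code on the
  walk decodes to two vertices. Here \<open>u\<close> and \<open>v\<close> themselves are the vertex
  maps.\<close>

lemma has_amalgamation_cat_AF: "has_amalgamation (cat_AF :: 'a::infinite rel_cat)"
  unfolding has_amalgamation_def
proof (intro ballI)
  fix G H I :: "'a graph" and R Q
  assume "G \<in> obj cat_AF" "H \<in> obj cat_AF" "I \<in> obj cat_AF"
    and R: "R \<in> mor cat_AF G H" and Q: "Q \<in> mor cat_AF G I"
  then have GHI: "is_path G" "is_path H" "is_path I" by (simp_all add: cat_A_def cat_AF_def)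
  have RA: "R \<in> mor cat_A G H" "function_rel H R" and QA: "Q \<in> mor cat_A G I" "function_rel I Q"
    using R Q by (simp_all add: cat_AF_def)
  obtain q n where q: "path_list G q" "length q = Suc n"
    using GHI(1) is_path_iff_path_list path_list_length by blast
  obtain p m f hi where p: "path_list H p" "length p = Suc m" and s: "interval_steps n m f hi"
    and Req: "R = interval_rel q p f hi"
    using mor_cat_A_interval_rel[OF q GHI(2) RA(1)] .
  obtain p' m' g hi' where p': "path_list I p'" "length p' = Suc m'"
    and s': "interval_steps n m' g hi'" and Qeq: "Q = interval_rel q p' g hi'"
    using mor_cat_A_interval_rel[OF q GHI(3) QA(1)] .
  have f: "\<forall>i\<le>m. f i = hi i" using function_rel_interval_rel[OF q p s] RA(2) Req by simp
  have g: "\<forall>i\<le>m'. g i = hi' i" using function_rel_interval_rel[OF q p' s'] QA(2) Qeq by simp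
  obtain N u v where u: "unit_steps m N u" and v: "unit_steps m' N v"
    and uv: "\<forall>j\<le>N. f (u j) = g (v j)"
    using common_walk[OF unit_steps_of_function[OF s f] unit_steps_of_function[OF s' g]] by blast
  obtain J :: "'a graph" and l where l: "path_list J l" "length l = Suc N"
    using ex_path_list by blast
  let ?R' = "interval_rel p l u u" and ?Q' = "interval_rel p' l v v"
  note su = interval_steps_function[OF u] and sv = interval_steps_function[OF v]
  have dp: "distinct p" "distinct p'" using p p' by (auto simp: path_list_def)
  \<comment> \<open>The upper ends agree with \<open>f\<close> and \<open>g\<close> only up to
    \<open>m\<close> and \<open>m'\<close>, hence the bounds on \<open>u\<close> and
    \<open>v\<close>.\<close>
  have "hi (u j) = hi' (v j)" if "j \<le> N" for j
    using that f g uv unit_steps_le[OF u] unit_steps_le[OF v] by metis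
  then have "R O ?R' = Q O ?Q'"
    unfolding Req Qeq interval_rel_comp[OF dp(1) p(2) l(2) s su]
      interval_rel_comp[OF dp(2) p'(2) l(2) s' sv]
    using uv l(2) by (intro interval_rel_cong) auto
  moreover have "?R' \<in> mor cat_AF H J" "?Q' \<in> mor cat_AF I J"
    using interval_rel_mor_cat_A[OF p l su] interval_rel_mor_cat_A[OF p' l sv]
      function_rel_interval_rel[OF p l su] function_rel_interval_rel[OF p' l sv]
    by (auto simp: cat_AF_def)
  moreover have "J \<in> obj cat_AF" using l is_path_iff_path_list by (auto simp: cat_A_def cat_AF_def)
  ultimately show "\<exists>J\<in>obj cat_AF. \<exists>R'\<in>mor cat_AF H J. \<exists>Q'\<in>mor cat_AF I J. R O R' = Q O Q'"
    by blast
qed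

theorem proposition5p13:
  shows "has_amalgamation (cat_A :: 'a::infinite rel_cat) \<and>
         has_amalgamation (cat_AF :: 'a::infinite rel_cat)"
  using has_amalgamation_cat_A has_amalgamation_cat_AF ..

end
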